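(* Let $p_n$ denote the $n$-th prime. For all $n\ge 2$ (so that $p_{n+1}-p_n\ge 2$), $$|\xi(p_{n+1})-\xi(p_n)|+2=p_{n+1}-p_n .$$ Consequently, Cramér's conjecture, i.e. the assertion that $p_{n+1}-p_n\ll(\log p_n)^2$, is equivalent to the assertion that $\xi(p_{n+1})-\xi(p_n)\ll(\log p_n)^2$.
   Context: For an integer $n\ge 1$ put $\iota(n)=(-1)^{\pi(n)}$, where $\pi(n)$ is the number of primes $\le n$. For real $x\ge 1$ put $\xi(x)=\sum_{n\le x}\iota(n)$, the sum running over integers $1\le n\le x$. The notation $f(n)\ll g(n)$ means that there is a constant $C>0$ with $|f(n)|\le C\,g(n)$ for all $n\ge 1$. *)

theory Defs
  imports Complex_Main "HOL-Library.Infinite_Set" "HOL-Computational_Algebra.Primes"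
begin

definition prime_pi :: "nat \<Rightarrow> nat" where
  "prime_pi n = card {p. prime p \<and> p \<le> n}"

definition iota :: "nat \<Rightarrow> int" where
  "iota n = (- 1) ^ prime_pi n"

definition xi :: "real \<Rightarrow> int" where
  "xi x = (\<Sum>n\<in>{n::nat. 1 \<le> n \<and> real n \<le> x}. iota n)"

(* Counting starts at 1, so nth_prime 1 = 2, whereas enumerate counts from 0.
   The value at index 0 is meaningless. *)
definition nth_prime :: "nat \<Rightarrow> nat" where
  "nth_prime n = enumerate {p. prime p} (n - 1)"

(* The bound is required for every n \<ge> 1, not just eventually. *)
definition much_less :: "(nat \<Rightarrow> real) \<Rightarrow> (nat \<Rightarrow> real) \<Rightarrow> bool"  (infix "\<lless>" 50) where
  "f \<lless> g \<longleftrightarrow> (\<exists>C>0. \<forall>n\<ge>1. \<bar>f n\<bar> \<le> C * g n)"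

definition cramer_conjecture :: bool where
  "cramer_conjecture \<longleftrightarrow>
     (\<lambda>n. real (nth_prime (n + 1)) - real (nth_prime n)) \<lless> (\<lambda>n. (ln (real (nth_prime n)))\<^sup>2)"

end

theory Submission
  imports Defs
begin

text \<open>
  Between consecutive primes \<open>p < q\<close> the sign \<open>iota\<close> equals \<open>iota p\<close> on the \<open>q - p - 1\<close>
  integers strictly in between and flips at \<open>q\<close>, so \<open>xi q - xi p = iota p * (q - p - 2)\<close>.
  The additive \<open>2\<close> is harmless for Cramer's bound because \<open>(ln p)^2 \<ge> (ln 2)^2 > 0\<close>.
\<close>

lemma xi_of_nat: "xi (real m) = (\<Sum>k\<in>{1..m}. iota k)"
  by (simp add: xi_def atLeastAtMost_def atLeast_def atMost_def Collect_conj_eq)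

lemma abs_iota: "\<bar>iota m\<bar> = 1"
  by (simp add: iota_def power_abs)

text \<open>No prime lies in the interval from \<open>p\<close> (excluded) to \<open>m\<close>
  (included), so both prime counts range over the same set.\<close>

lemma iota_between_primes:
  assumes "p \<le> m" and "\<And>r. prime r \<Longrightarrow> p < r \<Longrightarrow> m < r"
  shows "iota m = iota p"
proof -
  have "{r. prime r \<and> r \<le> m} = {r. prime r \<and> r \<le> p}"
  proof (intro Collect_cong conj_cong refl iffI)
    fix r assume "prime r" "r \<le> m"
    then show "r \<le> p"
      using assms(2)[of r] by linarith
  qed (use assms(1) in simp)
  then show ?thesis
    by (simp add: iota_def prime_pi_def)
qed

text \<open>The only prime above \<open>p\<close> and up to \<open>q\<close> is \<open>q\<close>
  itself, so the prime count grows by exactly one.\<close>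

lemma iota_next_prime:
  assumes "prime q" "p < q" and "\<And>r. prime r \<Longrightarrow> p < r \<Longrightarrow> q \<le> r"
  shows "iota q = - iota p"
proof -
  have "{r. prime r \<and> r \<le> q} = insert q {r. prime r \<and> r \<le> p}"
    using assms by (auto dest: antisym intro: leI le_trans)
  moreover have "finite {r. prime r \<and> r \<le> p}"
    by (rule finite_subset[of _ "{..p}"]) auto
  ultimately have "prime_pi q = Suc (prime_pi p)"
    using \<open>p < q\<close> by (simp add: prime_pi_def)
  then show ?thesis
    by (simp add: iota_def)
qed

text \<open>The \<open>q - p - 1\<close> interior terms all equal \<open>iota p\<close>, and the
  last term \<open>- iota p\<close> cancels one of them.\<close>

lemma xi_diff_consecutive_primes:
  assumes "prime q" "p < q" and next_prime: "\<And>r. prime r \<Longrightarrow> p < r \<Longrightarrow> q \<le> r"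
  shows "xi (real q) - xi (real p) = iota p * (int q - int p - 2)"
proof -
  have split: "{1..q} = {1..p} \<union> {p<..<q} \<union> {q}"
    using \<open>p < q\<close> prime_gt_0_nat[OF \<open>prime q\<close>] by auto
  have "xi (real q) = xi (real p) + (\<Sum>k\<in>{p<..<q}. iota k) + iota q"
    unfolding xi_of_nat split using \<open>p < q\<close>
    by (subst sum.union_disjoint; (subst sum.union_disjoint)?) auto
  also have "(\<Sum>k\<in>{p<..<q}. iota k) = (\<Sum>k\<in>{p<..<q}. iota p)"
    proof (intro sum.cong refl iota_between_primes)
    fix k r assume "k \<in> {p<..<q}" "prime r" "p < r"
    then show "k < r"
      using next_prime[of r] by simp
  qed simp
  also have "\<dots> = iota p * (int q - int p - 1)"
    using \<open>p < q\<close> by (simp add: of_nat_diff)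
  also have "iota q = - iota p"
    by (rule iota_next_prime[OF assms])
  finally show ?thesis
    by (simp add: algebra_simps)
qed

lemma prime_nth_prime: "prime (nth_prime n)"
  using enumerate_in_set[OF primes_infinite] by (simp add: nth_prime_def)

lemma nth_prime_less_Suc:
  assumes "n \<ge> 1"
  shows "nth_prime n < nth_prime (n + 1)"
  using enumerate_step[OF primes_infinite, of "n - 1"] assms by (simp add: nth_prime_def)

text \<open>\<open>enumerate\<close> takes as its next value the least element above the current
  one. With \<open>n \<ge> 1\<close> the truncated \<open>n - 1\<close> is a true
  predecessor.\<close>

lemma nth_prime_Suc_le:
  assumes "n \<ge> 1" "prime r" "nth_prime n < r"
  shows "nth_prime (n + 1) \<le> r"
  using assms enumerate_Suc''[OF primes_infinite, of "n - 1"]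
  by (auto simp: nth_prime_def intro: Least_le)

lemma xi_diff_nth_prime:
  assumes "n \<ge> 1"
  shows "xi (real (nth_prime (n + 1))) - xi (real (nth_prime n))
    = iota (nth_prime n) * (int (nth_prime (n + 1)) - int (nth_prime n) - 2)"
  using assms
  by (intro xi_diff_consecutive_primes prime_nth_prime nth_prime_less_Suc nth_prime_Suc_le)

text \<open>The absolute value stays on the right because at \<open>n = 1\<close> the gap is 3 - 2 =
  1 and the inner term is -1.\<close>

lemma abs_xi_diff_nth_prime:
  assumes "n \<ge> 1"
  shows "\<bar>xi (real (nth_prime (n + 1))) - xi (real (nth_prime n))\<bar>
    = \<bar>int (nth_prime (n + 1)) - int (nth_prime n) - 2\<bar>"
  by (simp only: xi_diff_nth_prime[OF assms] abs_mult abs_iota mult_1)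

lemma nth_prime_gap_ge_2:
  assumes "n \<ge> 2"
  shows "nth_prime n + 2 \<le> nth_prime (n + 1)"
proof -
  have "nth_prime (n - 1) < nth_prime n" "nth_prime n < nth_prime (n + 1)"
    using nth_prime_less_Suc[of "n - 1"] nth_prime_less_Suc[of n] assms by auto
  \<comment> \<open>A smaller prime before \<open>nth_prime n\<close> forces it and its successor
    above 2, hence both are odd.\<close>
  moreover have "nth_prime (n - 1) \<ge> 2"
    by (rule prime_ge_2_nat[OF prime_nth_prime])
  ultimately have "odd (nth_prime n)" "odd (nth_prime (n + 1))"
    using prime_odd_nat[OF prime_nth_prime, of n] prime_odd_nat[OF prime_nth_prime, of "n + 1"]
    by linarith+
  with \<open>nth_prime n < nth_prime (n + 1)\<close> show ?thesis
    by presburger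
qed

lemma two_le_ln_squared:
  assumes "p \<ge> 2"
  shows "2 \<le> 8 * (ln (real p))\<^sup>2"
proof -
  have "1 / 2 \<le> ln (2::real)"
    \<comment> \<open>This instance reads ln 1 - ln 2 \<le> (1 - 2) / 2. Squaring the bound 1/2
      gives 1/4, whence the factor 8.\<close>
    using ln_diff_le[of 1 2] by simp
  also have "\<dots> \<le> ln (real p)"
    using assms by simp
  finally have "(1 / 2)\<^sup>2 \<le> (ln (real p))\<^sup>2"
    by (intro power_mono) auto
  then show ?thesis
    by (simp add: power2_eq_square)
qed

lemma cramer_conjecture_iff_xi:
  "cramer_conjecture \<longleftrightarrow>
     (\<lambda>n. real_of_int (xi (real (nth_prime (n + 1))) - xi (real (nth_prime n))))
       \<lless> (\<lambda>n. (ln (real (nth_prime n)))\<^sup>2)"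
  (is "_ \<longleftrightarrow> ?d \<lless> ?L")
proof -
  define g where "g n = real (nth_prime (n + 1)) - real (nth_prime n)" for n
  have g: "g n \<ge> 1" and d: "\<bar>?d n\<bar> = \<bar>g n - 2\<bar>" if "n \<ge> 1" for n
  proof -
    show "g n \<ge> 1"
      using nth_prime_less_Suc[OF that] by (simp add: g_def)
    have "\<bar>?d n\<bar> = real_of_int \<bar>int (nth_prime (n + 1)) - int (nth_prime n) - 2\<bar>"
      by (simp only: of_int_abs[symmetric] abs_xi_diff_nth_prime[OF that])
    then show "\<bar>?d n\<bar> = \<bar>g n - 2\<bar>"
      by (simp add: g_def)
  qed
  have "g \<lless> ?L \<longleftrightarrow> ?d \<lless> ?L"
  proof
    assume "g \<lless> ?L"
    then obtain C where "C > 0" and C: "\<And>n. n \<ge> 1 \<Longrightarrow> \<bar>g n\<bar> \<le> C * ?L n"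
      unfolding much_less_def by blast
    have "\<bar>?d n\<bar> \<le> C * ?L n" if "n \<ge> 1" for n
      \<comment> \<open>From \<open>g n \<ge> 1\<close> follows
        \<open>\<bar>g n - 2\<bar> \<le> g n\<close>, which covers \<open>n = 1\<close> too.\<close>
      using C[OF that] d[OF that] g[OF that] by linarith
    with \<open>C > 0\<close> show "?d \<lless> ?L"
      unfolding much_less_def by blast
  next
    assume "?d \<lless> ?L"
    then obtain C where "C > 0" and C: "\<And>n. n \<ge> 1 \<Longrightarrow> \<bar>?d n\<bar> \<le> C * ?L n"
      unfolding much_less_def by blast
    \<comment> \<open>Here \<open>g n \<le> \<bar>g n - 2\<bar> + 2\<close>; the extra 2 is absorbed
      by \<open>8 * ?L n\<close>.\<close>
    have "\<bar>g n\<bar> \<le> (C + 8) * ?L n" if "n \<ge> 1" for n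
      unfolding distrib_right
      using C[OF that] d[OF that] g[OF that]
        two_le_ln_squared[OF prime_ge_2_nat[OF prime_nth_prime[of n]]]
      by linarith
    with \<open>C > 0\<close> show "g \<lless> ?L"
      unfolding much_less_def by (intro exI[of _ "C + 8"]) auto
  qed
  then show ?thesis
    unfolding cramer_conjecture_def g_def .
qed

theorem mainTheorem4:
  shows "(\<forall>n\<ge>2. int (nth_prime (n + 1)) - int (nth_prime n) \<ge> 2 \<and>
            \<bar>xi (real (nth_prime (n + 1))) - xi (real (nth_prime n))\<bar> + 2
              = int (nth_prime (n + 1)) - int (nth_prime n)) \<and>
         (cramer_conjecture \<longleftrightarrow>
            (\<lambda>n. real_of_int (xi (real (nth_prime (n + 1))) - xi (real (nth_prime n))))
              \<lless> (\<lambda>n. (ln (real (nth_prime n)))\<^sup>2))"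
proof (intro conjI allI impI cramer_conjecture_iff_xi)
  fix n :: nat
  assume n: "n \<ge> 2"
  show gap: "int (nth_prime (n + 1)) - int (nth_prime n) \<ge> 2"
    using nth_prime_gap_ge_2[OF n] by linarith
  show "\<bar>xi (real (nth_prime (n + 1))) - xi (real (nth_prime n))\<bar> + 2
    = int (nth_prime (n + 1)) - int (nth_prime n)"
    \<comment> \<open>The gap bound makes the term inside the right-hand absolute value
      nonnegative.\<close>
    using abs_xi_diff_nth_prime[of n] n gap by linarith
qed

end
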